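(* Let $\mathcal{H}$ be a real Hilbert space and let $\mu\in\left]0,\infty\right[$. Assume that $A\colon\mathcal{H}\rightrightarrows\mathcal{H}$ and $B\colon\mathcal{H}\rightrightarrows\mathcal{H}$ are maximal monotone, that $C\colon\mathcal{H}\to\mathcal{H}$ is (single-valued) monotone and $\mu$-Lipschitz continuous, and that $\operatorname{zer}(A+B+C)\neq\varnothing$. Let $\beta>0$ and $0<\gamma<\beta/(1+2\mu\beta)$. Let $x_0,x_{-1},u_0\in\mathcal{H}$ be arbitrary, and for $n=0,1,\dots$ define \[ \begin{cases} x_{n+1}=J_{\gamma B}\bigl(x_n-\gamma u_n-\gamma (2Cx_n-Cx_{n-1})\bigr)\\ y_{n+1}=J_{\beta A}(2x_{n+1}-x_n+\beta u_n)\\ u_{n+1}=u_n+\frac{1}{\beta}(2x_{n+1}-x_n-y_{n+1}). \end{cases} \] Then there exists $x_\star\in\operatorname{zer}(A+B+C)$ such that $x_n\rightharpoonup x_\star$.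
   Context: For a set-valued operator $M\colon\mathcal{H}\rightrightarrows\mathcal{H}$, $\operatorname{zer}(M)=\{x\in\mathcal{H}: 0\in Mx\}$, and $J_M=(\mathrm{Id}+M)^{-1}$ is its resolvent, which is single-valued with domain $\mathcal{H}$ when $M$ is maximal monotone. The symbol $\rightharpoonup$ denotes weak convergence in $\mathcal{H}$. *)

theory Defs
  imports "HOL-Analysis.Analysis"
begin

text \<open>
  A set-valued operator on a space \<open>'a\<close> is a function \<open>'a \<Rightarrow> 'a set\<close>.  A real Hilbert space is a
  type of sort \<open>{real_inner, complete_space}\<close>; no finiteness of dimension is involved.
\<close>

type_synonym 'a setop = "'a \<Rightarrow> 'a set"

definition graph_op :: "'a setop \<Rightarrow> ('a \<times> 'a) set" where
  "graph_op M = {(x, u). u \<in> M x}"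

definition single_op :: "('a \<Rightarrow> 'a) \<Rightarrow> 'a setop" where
  "single_op f = (\<lambda>x. {f x})"

text \<open>The sum on the right-hand side is the Minkowski sum, which is empty if one summand is.\<close>

definition add_op :: "'a::real_vector setop \<Rightarrow> 'a setop \<Rightarrow> 'a setop"  (infixl \<open>\<oplus>\<^sub>o\<close> 65) where
  "M \<oplus>\<^sub>o N = (\<lambda>x. M x + N x)"

definition scale_op :: "real \<Rightarrow> 'a::real_vector setop \<Rightarrow> 'a setop"  (infixr \<open>\<cdot>\<^sub>o\<close> 75) where
  "c \<cdot>\<^sub>o M = (\<lambda>x. (\<lambda>u. c *\<^sub>R u) ` M x)"

definition inverse_op :: "'a setop \<Rightarrow> 'a setop" where
  "inverse_op M = (\<lambda>u. {x. u \<in> M x})"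

definition zer :: "'a::zero setop \<Rightarrow> 'a set" where
  "zer M = {x. 0 \<in> M x}"

definition monotone_op :: "'a::real_inner setop \<Rightarrow> bool" where
  "monotone_op M \<longleftrightarrow>
     (\<forall>(x, u) \<in> graph_op M. \<forall>(y, v) \<in> graph_op M. inner (x - y) (u - v) \<ge> 0)"

definition maximal_monotone_op :: "'a::real_inner setop \<Rightarrow> bool" where
  "maximal_monotone_op M \<longleftrightarrow>
     monotone_op M \<and> \<not> (\<exists>N. monotone_op N \<and> graph_op M \<subset> graph_op N)"

text \<open>
  The resolvent \<open>(Id + M)\<^sup>-\<^sup>1\<close> as a point-to-point map.  The value at \<open>x\<close> is unspecified when
  the set-valued inverse is not a singleton at \<open>x\<close>; for maximal monotone \<open>M\<close> on a Hilbert
  space this never happens, by Minty's theorem.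
\<close>

definition resolvent :: "'a::real_inner setop \<Rightarrow> 'a \<Rightarrow> 'a" where
  "resolvent M x = the_elem (inverse_op (single_op id \<oplus>\<^sub>o M) x)"

definition weakly_converges :: "(nat \<Rightarrow> 'a::real_inner) \<Rightarrow> 'a \<Rightarrow> bool"
    (infix \<open>\<rightharpoonup>\<close> 60) where
  "X \<rightharpoonup> l \<longleftrightarrow> (\<forall>y. (\<lambda>n. inner (X n) y) \<longlonglongrightarrow> inner l y)"

end

theory Submission
  imports Defs "HOL-Library.Diagonal_Subsequence"
begin

text \<open>
  In the metric \<open>V (p, q) = \<parallel>p\<parallel>\<^sup>2 / \<gamma> - 2 \<langle>p, q\<rangle> + \<beta> \<parallel>q\<parallel>\<^sup>2\<close> the pairs \<open>(x\<^sub>n, u\<^sub>n)\<close> form a forward-reflected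
  iteration for the primal-dual inclusion \<open>u \<in> A x\<close>, \<open>-u - C x \<in> B x\<close>. The energy
  \<open>V (x\<^sub>n - x, u\<^sub>n - u) - 2 \<langle>C x\<^sub>n - C x\<^sub>n\<^sub>-\<^sub>1, x\<^sub>n - x\<rangle> + \<mu> \<parallel>x\<^sub>n - x\<^sub>n\<^sub>-\<^sub>1\<parallel>\<^sup>2\<close> with respect to a solution \<open>(x, u)\<close>
  decreases by a quadratic form in the increments; the step-size condition says exactly that
  this form, which also bounds the energy from below, is positive definite. Hence the iterates
  are bounded, the increments vanish, weak cluster points solve the inclusion, and Opial's
  argument in the metric \<open>V\<close> shows that there is only one.
\<close>

section \<open>Minimisation and representation in Hilbert spaces\<close>

text \<open>\<open>K\<close> plays the epigraph of a convex function, so extended-valued functions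
  are covered. By the parallelogram identity every minimising sequence of
  \<open>t + (norm z)^2 / 2\<close> is Cauchy in its \<open>z\<close> component; moving from the
  minimiser a fraction \<open>s\<close> towards another point and letting \<open>s\<close> tend to 0
  gives the first-order condition.\<close>

lemma hilbert_min_first_order:
  fixes K :: "('b::{real_inner, complete_space} \<times> real) set"
  assumes "closed K" "convex K" "K \<noteq> {}"
    and bound: "\<And>z t. (z, t) \<in> K \<Longrightarrow> m0 \<le> t + (norm z)\<^sup>2 / 2"
  obtains z0 t0 where "(z0, t0) \<in> K"
    and "\<And>z t. (z, t) \<in> K \<Longrightarrow> 0 \<le> t - t0 + inner z0 (z - z0)"
proof -
  define h where "h = (\<lambda>p::'b \<times> real. snd p + (norm (fst p))\<^sup>2 / 2)"
  define m where "m = Inf (h ` K)"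
  have bdd: "bdd_below (h ` K)"
    using bound by (intro bdd_belowI[of _ m0]) (auto simp: h_def)
  have lower: "m \<le> h p" if "p \<in> K" for p
    unfolding m_def using bdd that by (intro cInf_lower) auto
  have "\<exists>p \<in> K. h p < m + 1 / real (Suc n)" for n
    using cInf_lessD[of "h ` K" "m + 1 / real (Suc n)"] assms(3) by (auto simp: m_def)
  then obtain w where wK: "w n \<in> K" and wh: "h (w n) < m + 1 / real (Suc n)" for n
    by metis
  \<comment> \<open>The midpoint value is
    \<open>(h p + h q) / 2 - (norm (fst p - fst q))^2 / 8\<close>, and it is at least
    \<open>m\<close>.\<close>
  have par: "(norm (fst p - fst q))\<^sup>2 \<le> 4 * (h p + h q - 2 * m)" if "p \<in> K" "q \<in> K" for p q
  proof -
    have "(1/2) *\<^sub>R p + (1/2) *\<^sub>R q \<in> K"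
      using assms(2) that by (intro convexD) auto
    from lower[OF this] show ?thesis
      by (simp add: h_def power2_norm_eq_inner inner_simps inner_commute algebra_simps)
        (simp add: field_simps)
  qed
  have "Cauchy (\<lambda>n. fst (w n))"
  proof (rule metric_CauchyI)
    fix e :: real assume "e > 0"
    then obtain N where N: "inverse (real (Suc N)) < e\<^sup>2 / 8"
      using reals_Archimedean[of "e\<^sup>2 / 8"] by auto
    have "dist (fst (w i)) (fst (w j)) < e" if "i \<ge> N" "j \<ge> N" for i j
    proof -
      have near: "h (w k) < m + e\<^sup>2 / 8" if "k \<ge> N" for k
      proof -
        have "1 / real (Suc k) \<le> inverse (real (Suc N))"
          using that by (simp add: field_simps)
        with wh[of k] N show ?thesis by linarith
      qed
      have "(norm (fst (w i) - fst (w j)))\<^sup>2 \<le> 4 * (h (w i) + h (w j) - 2 * m)"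
        by (intro par wK)
      also have "\<dots> < e\<^sup>2"
        using near[OF that(1)] near[OF that(2)] by simp
      finally show ?thesis
        using \<open>e > 0\<close> by (simp add: dist_norm power_less_imp_less_base)
    qed
    then show "\<exists>M. \<forall>i\<ge>M. \<forall>j\<ge>M. dist (fst (w i)) (fst (w j)) < e" by blast
  qed
  then obtain z0 where z0: "(\<lambda>n. fst (w n)) \<longlonglongrightarrow> z0"
    by (auto simp: Cauchy_convergent_iff convergent_def)
  \<comment> \<open>This makes \<open>h (z0, t0) = m\<close>; the real components converge to
    \<open>t0\<close> because \<open>h (w n)\<close> and \<open>fst (w n)\<close> both
    converge.\<close>
  define t0 where "t0 = m - (norm z0)\<^sup>2 / 2"
  have hm: "(\<lambda>n. h (w n)) \<longlonglongrightarrow> m"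
  proof (rule tendsto_sandwich[OF _ _ tendsto_const])
    show "(\<lambda>n. m + inverse (real (Suc n))) \<longlonglongrightarrow> m"
      by (rule LIMSEQ_inverse_real_of_nat_add)
    show "\<forall>\<^sub>F n in sequentially. h (w n) \<le> m + inverse (real (Suc n))"
      using wh by (intro always_eventually allI less_imp_le) (simp add: inverse_eq_divide)
  qed (use lower wK in auto)
  have "(\<lambda>n. snd (w n)) \<longlonglongrightarrow> t0"
    using tendsto_diff[OF hm tendsto_divide[OF tendsto_power[OF tendsto_norm[OF z0], of 2]
          tendsto_const[of 2]]]
    by (simp add: h_def t0_def)
  from tendsto_Pair[OF z0 this] have mem: "(z0, t0) \<in> K"
    by (rule closed_sequentially[OF assms(1), rotated]) (simp add: wK)
  show ?thesis
  proof (rule that[OF mem])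
    fix z t assume zt: "(z, t) \<in> K"
    have "0 \<le> t - t0 + inner z0 (z - z0) + s / 2 * (norm (z - z0))\<^sup>2" if s: "0 < s" "s \<le> 1" for s
    proof -
      have "(1 - s) *\<^sub>R (z0, t0) + s *\<^sub>R (z, t) \<in> K"
        using assms(2) mem zt s by (intro convexD) auto
      from lower[OF this] have "0 \<le> s * (t - t0 + inner z0 (z - z0) + s / 2 * (norm (z - z0))\<^sup>2)"
        by (simp add: h_def t0_def power2_norm_eq_inner inner_simps inner_commute algebra_simps)
          (simp add: field_simps)
      then show ?thesis using s by (simp add: zero_le_mult_iff)
    qed
    then have ev: "\<forall>\<^sub>F s in at_right 0. 0 \<le> t - t0 + inner z0 (z - z0) + s / 2 * (norm (z - z0))\<^sup>2"
      by (intro eventually_at_rightI[of 0 1]) auto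
    have "((\<lambda>s. t - t0 + inner z0 (z - z0) + s / 2 * (norm (z - z0))\<^sup>2)
        \<longlongrightarrow> t - t0 + inner z0 (z - z0) + 0 / 2 * (norm (z - z0))\<^sup>2) (at_right 0)"
      by (intro tendsto_intros) auto
    from tendsto_lowerbound[OF this ev] show "0 \<le> t - t0 + inner z0 (z - z0)" by simp
  qed
qed

text \<open>Minimise \<open>(norm v)^2 / 2 - f v\<close> over \<open>S\<close>; the first-order
  inequality in the directions \<open>v\<close> and \<open>-v\<close> becomes an equality. Working
  relative to \<open>S\<close> lets the lemma also supply orthogonal projections, by taking
  \<open>f = inner y\<close>.\<close>

lemma riesz_on_closed_subspace:
  fixes S :: "'b::{real_inner, complete_space} set"
  assumes "subspace S" "closed S"
    and add: "\<And>v w. v \<in> S \<Longrightarrow> w \<in> S \<Longrightarrow> f (v + w) = f v + f w"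
    and scale: "\<And>c v. v \<in> S \<Longrightarrow> f (c *\<^sub>R v) = c * f v"
    and bound: "\<And>v. v \<in> S \<Longrightarrow> \<bar>f v\<bar> \<le> M * norm v"
  obtains l where "l \<in> S" "\<And>v. v \<in> S \<Longrightarrow> f v = inner l v"
proof -
  define K where "K = {(v, t). v \<in> S \<and> - f v \<le> t}"
  have diff: "f (v - w) = f v - f w" if "v \<in> S" "w \<in> S" for v w
    using add[of v "(-1) *\<^sub>R w"] scale[of w "-1"] that subspace_scale[OF assms(1), of w "-1"] by simp
  have "closed K"
    unfolding closed_sequential_limits
  proof (intro allI impI, elim conjE)
    fix p l assume p: "\<forall>n. p n \<in> K" and "p \<longlonglongrightarrow> l"
    from tendsto_fst[OF this(2)] tendsto_snd[OF this(2)]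
    have l1: "(\<lambda>n. fst (p n)) \<longlonglongrightarrow> fst l" and l2: "(\<lambda>n. snd (p n)) \<longlonglongrightarrow> snd l" .
    have pS: "fst (p n) \<in> S" for n using p by (auto simp: K_def case_prod_beta)
    have lS: "fst l \<in> S"
      using closed_sequentially[OF assms(2) pS l1] .
    have "(\<lambda>n. f (fst (p n)) - f (fst l)) \<longlonglongrightarrow> 0"
    proof (rule Lim_null_comparison)
      show "\<forall>\<^sub>F n in sequentially. norm (f (fst (p n)) - f (fst l)) \<le> M * norm (fst (p n) - fst l)"
        using bound[OF subspace_diff[OF assms(1) pS lS]] diff[OF pS lS] by simp
      show "(\<lambda>n. M * norm (fst (p n) - fst l)) \<longlonglongrightarrow> 0"
        using l1 by (intro tendsto_mult_right_zero tendsto_norm_zero) (simp add: LIM_zero)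
    qed
    then have "(\<lambda>n. f (fst (p n))) \<longlonglongrightarrow> f (fst l)" by (simp add: LIM_zero_iff)
    moreover have "- f (fst (p n)) \<le> snd (p n)" for n
      using p by (auto simp: K_def case_prod_beta)
    ultimately have "- f (fst l) \<le> snd l"
      using LIMSEQ_le[OF tendsto_minus l2] by blast
    with lS show "l \<in> K" by (auto simp: K_def case_prod_beta)
  qed
  moreover have "convex K"
  proof (rule convexI, clarify)
    fix v t w s and a b :: real
    assume *: "(v, t) \<in> K" "(w, s) \<in> K" "0 \<le> a" "0 \<le> b" "a + b = 1"
    then have "- f v \<le> t" "- f w \<le> s" by (auto simp: K_def)
    from mult_left_mono[OF this(1) *(3)] mult_left_mono[OF this(2) *(4)]
    show "a *\<^sub>R (v, t) + b *\<^sub>R (w, s) \<in> K"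
      using * assms(1) by (auto simp: K_def add scale subspace_add subspace_scale)
  qed
  moreover have "K \<noteq> {}"
    using subspace_0[OF assms(1)] by (auto simp: K_def)
  moreover have "- M\<^sup>2 / 2 \<le> t + (norm v)\<^sup>2 / 2" if "(v, t) \<in> K" for v t
  proof -
    have "- (M * norm v) \<le> t" using that bound[of v] by (auto simp: K_def)
    moreover have "0 \<le> (M - norm v)\<^sup>2" by simp
    ultimately show ?thesis by (simp add: power2_diff)
  qed
  ultimately obtain z0 t0 where mem: "(z0, t0) \<in> K"
    and opt: "\<And>z t. (z, t) \<in> K \<Longrightarrow> 0 \<le> t - t0 + inner z0 (z - z0)"
    using hilbert_min_first_order by blast
  have z0: "z0 \<in> S" "- f z0 \<le> t0" using mem by (auto simp: K_def)
  have le: "f v \<le> inner z0 v" if "v \<in> S" for v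
  proof -
    have "(z0 + v, - f (z0 + v)) \<in> K"
      using z0 that assms(1) by (auto simp: K_def subspace_add)
    from opt[OF this] show ?thesis using z0 that by (simp add: add)
  qed
  have "f v = inner z0 v" if "v \<in> S" for v
    using le[OF that] le[of "(-1) *\<^sub>R v"] scale[OF that, of "-1"] that
      subspace_scale[OF assms(1) that, of "-1"] by simp
  with z0 show ?thesis using that by blast
qed

section \<open>Weak sequential compactness\<close>

lemma weakly_converges_subseq:
  assumes "X \<rightharpoonup> l" "strict_mono r"
  shows "(X \<circ> r) \<rightharpoonup> l"
  unfolding weakly_converges_def
proof
  fix y
  have "(\<lambda>n. inner (X n) y) \<longlonglongrightarrow> inner l y" using assms(1) by (simp add: weakly_converges_def)
  from LIMSEQ_subseq_LIMSEQ[OF this assms(2)]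
  show "(\<lambda>n. inner ((X \<circ> r) n) y) \<longlonglongrightarrow> inner l y" by (simp add: o_def)
qed

lemma weakly_converges_add_null:
  assumes "X \<rightharpoonup> l" "(\<lambda>n. Y n - X n) \<longlonglongrightarrow> 0"
  shows "Y \<rightharpoonup> l"
  unfolding weakly_converges_def
proof
  fix y
  have "(\<lambda>n. inner (X n) y) \<longlonglongrightarrow> inner l y" using assms(1) by (simp add: weakly_converges_def)
  from tendsto_add[OF this tendsto_inner[OF assms(2) tendsto_const[of y]]]
  show "(\<lambda>n. inner (Y n) y) \<longlonglongrightarrow> inner l y" by (simp add: inner_simps)
qed

lemma weakly_converges_fst_snd:
  assumes "Z \<rightharpoonup> l"
  shows "(\<lambda>n. fst (Z n)) \<rightharpoonup> fst l" "(\<lambda>n. snd (Z n)) \<rightharpoonup> snd l"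
proof -
  have *: "(\<lambda>n. inner (Z n) y) \<longlonglongrightarrow> inner l y" for y
    using assms by (simp add: weakly_converges_def del: split_paired_All)
  show "(\<lambda>n. fst (Z n)) \<rightharpoonup> fst l" "(\<lambda>n. snd (Z n)) \<rightharpoonup> snd l"
    using *[of "(y, 0)" for y] *[of "(0, y)" for y]
    by (simp_all add: weakly_converges_def inner_prod_def)
qed

text \<open>A diagonal subsequence converges when tested against each term of the sequence. The
  vectors against which it converges form a closed subspace, and projecting onto that subspace
  extends convergence to all test vectors. The limit functional is then represented by a
  vector.\<close>

lemma bounded_imp_weakly_convergent_subseq:
  fixes z :: "nat \<Rightarrow> 'b::{real_inner, complete_space}"
  assumes "bounded (range z)"
  obtains l r where "strict_mono (r :: nat \<Rightarrow> nat)" "(z \<circ> r) \<rightharpoonup> l"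
proof -
  obtain M where M: "norm (z n) \<le> M" for n
    using assms by (auto simp: bounded_iff)
  have M0: "0 \<le> M" using M[of 0] norm_ge_zero[of "z 0"] by linarith
  have bnd: "\<bar>inner (z n) y\<bar> \<le> M * norm y" for n y
    using Cauchy_Schwarz_ineq2[of "z n" y] mult_right_mono[OF M[of n] norm_ge_zero[of y]] by linarith
  interpret sub: subseqs "\<lambda>m s. convergent (\<lambda>k. inner (z (s k)) (z m))"
  proof
    fix m and s :: "nat \<Rightarrow> nat"
    have "bounded (range (\<lambda>k. inner (z (s k)) (z m)))"
      using bnd by (intro boundedI[of _ "M * norm (z m)"]) auto
    from bounded_imp_convergent_subsequence[OF this]
    show "\<exists>r'. strict_mono r' \<and> convergent (\<lambda>k. inner (z ((s \<circ> r') k)) (z m))"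
      by (auto simp: convergent_def o_def)
  qed
  define r where "r = sub.diagseq"
  have r: "strict_mono r" unfolding r_def by (rule sub.subseq_diagseq)
  define S where "S = {y. convergent (\<lambda>k. inner (z (r k)) y)}"
  have zS: "z m \<in> S" for m
  proof -
    \<comment> \<open>The diagonal sequence inherits the \<open>m\<close>-th property only after its
      first \<open>Suc m\<close> entries are dropped.\<close>
    have "convergent (\<lambda>k. inner (z ((sub.diagseq \<circ> ((+) (Suc m))) k)) (z m))"
    proof (rule sub.diagseq_holds)
      fix q s :: "nat \<Rightarrow> nat" and n
      assume "strict_mono q" "convergent (\<lambda>k. inner (z (s k)) (z n))"
      from convergent_subseq_convergent[OF this(2,1)]
      show "convergent (\<lambda>k. inner (z ((s \<circ> q) k)) (z n))" by (simp add: o_def)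
    qed
    then have "convergent (\<lambda>k. inner (z (r (k + Suc m))) (z m))"
      by (simp add: r_def add.commute)
    then show ?thesis
      unfolding S_def mem_Collect_eq using convergent_ignore_initial_segment[of _ "Suc m"] by blast
  qed
  have sub: "subspace S"
    by (rule subspaceI)
      (auto simp: S_def inner_simps intro: convergent_add convergent_mult convergent_const)
  have clo: "closed S"
    unfolding closed_sequential_limits
  proof (intro allI impI, elim conjE)
    fix v l assume v: "\<forall>n. v n \<in> S" and vl: "v \<longlonglongrightarrow> l"
    have "Cauchy (\<lambda>k. inner (z (r k)) l)"
    proof (rule metric_CauchyI)
      fix e :: real assume e: "e > 0"
      \<comment> \<open>\<open>M + 1\<close> rather than \<open>M\<close> keeps the denominator
        positive when \<open>M = 0\<close>.\<close>
      have "\<forall>\<^sub>F n in sequentially. dist (v n) l < e / (3 * (M + 1))"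
        using e M0 by (intro tendstoD[OF vl]) auto
      then obtain n where n: "norm (l - v n) < e / (3 * (M + 1))"
        by (auto simp: eventually_sequentially dist_norm norm_minus_commute)
      have small: "\<bar>inner (z k) (l - v n)\<bar> < e / 3" for k
      proof -
        have "\<bar>inner (z k) (l - v n)\<bar> \<le> (M + 1) * norm (l - v n)"
          using bnd[of k "l - v n"] norm_ge_zero[of "l - v n"] unfolding distrib_right by linarith
        also have "\<dots> < e / 3"
          using n M0 by (simp add: field_simps)
        finally show ?thesis .
      qed
      have "Cauchy (\<lambda>k. inner (z (r k)) (v n))"
        using v by (auto simp: S_def Cauchy_convergent_iff)
      from metric_CauchyD[OF this, of "e/3"] e obtain N
        where N: "\<bar>inner (z (r i)) (v n) - inner (z (r j)) (v n)\<bar> < e / 3" if "i \<ge> N" "j \<ge> N" for i j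
        by (auto simp: dist_real_def)
      have "dist (inner (z (r i)) l) (inner (z (r j)) l) < e" if "i \<ge> N" "j \<ge> N" for i j
        using N[OF that] small[of "r i"] small[of "r j"]
        unfolding dist_real_def inner_diff_right by linarith
      then show "\<exists>N. \<forall>i\<ge>N. \<forall>j\<ge>N. dist (inner (z (r i)) l) (inner (z (r j)) l) < e"
        by (intro exI[of _ N]) simp
    qed
    then show "l \<in> S" by (simp add: S_def Cauchy_convergent_iff)
  qed
  \<comment> \<open>Only the projection of a test vector onto the closed subspace containing the sequence matters.\<close>
  have "y \<in> S" for y
  proof -
    obtain l where l: "l \<in> S" "\<And>v. v \<in> S \<Longrightarrow> inner y v = inner l v"
      using riesz_on_closed_subspace[OF sub clo, of "inner y" "norm y"]
      by (auto simp: inner_simps Cauchy_Schwarz_ineq2)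
    have "(\<lambda>k. inner (z (r k)) y) = (\<lambda>k. inner (z (r k)) l)"
      using l(2)[OF zS] by (auto simp: inner_commute)
    with l(1) show ?thesis by (simp add: S_def)
  qed
  then have lim: "(\<lambda>k. inner (z (r k)) y) \<longlonglongrightarrow> lim (\<lambda>k. inner (z (r k)) y)" for y
    by (simp add: S_def convergent_LIMSEQ_iff)
  define f where "f = (\<lambda>y. lim (\<lambda>k. inner (z (r k)) y))"
  have f: "(\<lambda>k. inner (z (r k)) y) \<longlonglongrightarrow> f y" for y
    using lim by (simp add: f_def)
  have "f (v + w) = f v + f w" for v w
    using tendsto_add[OF f f, of v w] f[of "v + w"] LIMSEQ_unique by (auto simp: inner_simps)
  moreover have "f (c *\<^sub>R v) = c * f v" for c v
    using tendsto_mult_left[OF f, of c v] f[of "c *\<^sub>R v"] LIMSEQ_unique by (auto simp: inner_simps)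
  moreover have "\<bar>f v\<bar> \<le> M * norm v" for v
    using tendsto_upperbound[OF tendsto_rabs[OF f]] bnd by auto
  ultimately obtain l where "\<And>v. f v = inner l v"
    using riesz_on_closed_subspace[OF subspace_UNIV closed_UNIV, of f M] by (metis UNIV_I)
  with f have "(z \<circ> r) \<rightharpoonup> l"
    by (simp add: weakly_converges_def)
  with r show ?thesis using that by blast
qed

text \<open>Otherwise some subsequence stays at distance \<open>e\<close> from the limit when tested
  against one vector \<open>y\<close>, yet a further subsequence converges weakly, necessarily to
  \<open>l\<close>.\<close>

lemma weakly_convergesI_unique_cluster:
  fixes z :: "nat \<Rightarrow> 'b::{real_inner, complete_space}"
  assumes "bounded (range z)"
    and uniq: "\<And>r l'. strict_mono r \<Longrightarrow> (z \<circ> r) \<rightharpoonup> l' \<Longrightarrow> l' = l"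
  shows "z \<rightharpoonup> l"
proof (rule ccontr)
  assume "\<not> z \<rightharpoonup> l"
  then obtain y e where e: "e > 0" "\<exists>\<^sub>F n in sequentially. e \<le> dist (inner (z n) y) (inner l y)"
    by (auto simp: weakly_converges_def tendsto_iff not_eventually not_less)
  then have "infinite {n. e \<le> dist (inner (z n) y) (inner l y)}"
    by (simp add: frequently_cofinite cofinite_eq_sequentially[symmetric])
  then obtain r :: "nat \<Rightarrow> nat" where r: "strict_mono r" "\<And>n. e \<le> dist (inner (z (r n)) y) (inner l y)"
    using infinite_enumerate by blast
  have "bounded (range (z \<circ> r))"
    by (rule bounded_subset[OF assms(1)]) auto
  then obtain l' r' where r': "strict_mono r'" "((z \<circ> r) \<circ> r') \<rightharpoonup> l'"
    using bounded_imp_weakly_convergent_subseq by blast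
  then have "l' = l"
    using uniq[of "r \<circ> r'" l'] r(1) by (simp add: strict_mono_o comp_assoc)
  with r'(2) have "(\<lambda>n. inner (z (r (r' n))) y) \<longlonglongrightarrow> inner l y"
    by (simp add: weakly_converges_def)
  then have "\<forall>\<^sub>F n in sequentially. dist (inner (z (r (r' n))) y) (inner l y) < e"
    using e(1) by (rule tendstoD)
  then show False
    using r(2) by (auto simp: eventually_sequentially not_less[symmetric])
qed

section \<open>Maximal monotone operators\<close>

lemma monotone_opD:
  assumes "monotone_op M" "u \<in> M x" "v \<in> M y"
  shows "0 \<le> inner (x - y) (u - v)"
  using assms by (auto simp: monotone_op_def graph_op_def)

text \<open>Adjoining to the graph a single point that is monotonically related to all of it yields
  a monotone extension, so maximality can be tested pointwise.\<close>

lemma maximal_monotone_op_iff: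
  "maximal_monotone_op M \<longleftrightarrow> monotone_op M \<and>
     (\<forall>x u. (\<forall>a a'. a' \<in> M a \<longrightarrow> 0 \<le> inner (x - a) (u - a')) \<longrightarrow> u \<in> M x)"
proof (intro iffI conjI allI impI)
  fix x u
  assume max: "maximal_monotone_op M" and rel: "\<forall>a a'. a' \<in> M a \<longrightarrow> 0 \<le> inner (x - a) (u - a')"
  define N where "N = (\<lambda>z. if z = x then insert u (M x) else M z)"
  have "inner (a - x) (a' - u) = inner (x - a) (u - a')" for a a'
    by (simp add: inner_simps algebra_simps)
  then have "monotone_op N"
    using max rel by (auto simp: monotone_op_def graph_op_def N_def maximal_monotone_op_def)
  then have "\<not> graph_op M \<subset> graph_op N"
    using max by (auto simp: maximal_monotone_op_def)
  then show "u \<in> M x"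
    by (auto simp: graph_op_def N_def split: if_splits)
next
  assume M: "monotone_op M \<and>
     (\<forall>x u. (\<forall>a a'. a' \<in> M a \<longrightarrow> 0 \<le> inner (x - a) (u - a')) \<longrightarrow> u \<in> M x)"
  show "maximal_monotone_op M"
    unfolding maximal_monotone_op_def
  proof (intro conjI notI)
    assume "\<exists>N. monotone_op N \<and> graph_op M \<subset> graph_op N"
    then obtain N where N: "monotone_op N" "graph_op M \<subset> graph_op N" by blast
    then obtain x u where xu: "u \<in> N x" "u \<notin> M x" by (auto simp: graph_op_def)
    have "0 \<le> inner (x - a) (u - a')" if "a' \<in> M a" for a a'
      using N that xu(1) by (intro monotone_opD[of N]) (auto simp: graph_op_def)
    with M xu(2) show False by blast
  qed (use M in blast)
qed (auto simp: maximal_monotone_op_def)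

lemma maximal_monotone_op_monotone: "maximal_monotone_op M \<Longrightarrow> monotone_op M"
  by (simp add: maximal_monotone_op_def)

lemma maximal_monotone_opD:
  assumes "maximal_monotone_op M" "\<And>a a'. a' \<in> M a \<Longrightarrow> 0 \<le> inner (x - a) (u - a')"
  shows "u \<in> M x"
  using assms by (auto simp: maximal_monotone_op_iff)

text \<open>For a graph point take the point itself. Such test points turn a nonnegative sum of
  several pairings into simultaneous membership: each summand is nonpositive, and strictly negative
  if its membership fails.\<close>

lemma maximal_monotone_op_witness:
  assumes "maximal_monotone_op M"
  obtains a a' where "a' \<in> M a" "inner (x - a) (u - a') \<le> 0"
    and "u \<notin> M x \<Longrightarrow> inner (x - a) (u - a') < 0"
proof (cases "u \<in> M x")
  case True
  then show ?thesis using that[of u x] by simp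
next
  case False
  then show ?thesis using that maximal_monotone_opD[OF assms] by (meson less_imp_le not_le)
qed

section \<open>Minty's theorem and resolvents\<close>

text \<open>
  Minimise \<open>F (x, u) + (\<parallel>x\<parallel>\<^sup>2 + \<parallel>u\<parallel>\<^sup>2) / 2\<close> for the Fitzpatrick function \<open>F\<close> of \<open>M\<close>; the set \<open>K\<close>
  in the proof is the epigraph of \<open>F\<close>. Maximality gives \<open>F (x, u) \<ge> \<langle>x, u\<rangle>\<close>, and the first-order
  condition at the minimiser \<open>(x\<^sub>0, u\<^sub>0)\<close> shows that \<open>(-u\<^sub>0, -x\<^sub>0)\<close> is monotonically related
  to \<open>M\<close>.
\<close>

lemma maximal_monotone_op_minus_mem:
  fixes M :: "'a::{real_inner, complete_space} setop"
  assumes max: "maximal_monotone_op M"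
  shows "\<exists>x. - x \<in> M x"
proof -
  note mono = monotone_opD[OF maximal_monotone_op_monotone[OF max]]
  define K where "K = {p :: ('a \<times> 'a) \<times> real. \<forall>a a'. a' \<in> M a \<longrightarrow>
    inner (fst (fst p)) a' + inner a (snd (fst p)) - inner a a' \<le> snd p}"
  have "closed K"
    unfolding K_def
    by (intro closed_Collect_all closed_Collect_imp open_Collect_const closed_Collect_le
        continuous_intros)
  moreover have "convex K"
  proof (rule convexI)
    fix p q and s t :: real
    assume *: "p \<in> K" "q \<in> K" "0 \<le> s" "0 \<le> t" "s + t = 1"
    show "s *\<^sub>R p + t *\<^sub>R q \<in> K"
      unfolding K_def mem_Collect_eq
    proof (intro allI impI)
      fix a a' assume "a' \<in> M a"
      with * have "inner (fst (fst p)) a' + inner a (snd (fst p)) - inner a a' \<le> snd p"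
        "inner (fst (fst q)) a' + inner a (snd (fst q)) - inner a a' \<le> snd q"
        by (auto simp: K_def)
      from mult_left_mono[OF this(1) *(3)] mult_left_mono[OF this(2) *(4)]
      have "s * inner (fst (fst p)) a' + s * inner a (snd (fst p))
          + (t * inner (fst (fst q)) a' + t * inner a (snd (fst q))) - (s + t) * inner a a'
        \<le> s * snd p + t * snd q"
        by (simp add: algebra_simps)
      then show "inner (fst (fst (s *\<^sub>R p + t *\<^sub>R q))) a' + inner a (snd (fst (s *\<^sub>R p + t *\<^sub>R q)))
          - inner a a' \<le> snd (s *\<^sub>R p + t *\<^sub>R q)"
        using *(5) by (simp add: inner_simps algebra_simps)
    qed
  qed
  moreover have graph: "((a, a'), inner a a') \<in> K" if "a' \<in> M a" for a a'
    using mono[OF that] by (auto simp: K_def inner_simps algebra_simps)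
  moreover obtain a a' where "a' \<in> M a"
    using maximal_monotone_opD[OF max, of 0 0] by blast
  \<comment> \<open>Were it false, \<open>z\<close> would be monotonically related to
    \<open>M\<close>, hence in its graph, and testing \<open>z\<close> against itself would give the
    bound after all.\<close>
  moreover have low: "inner (fst z) (snd z) \<le> t" if "(z, t) \<in> K" for z t
  proof (rule ccontr)
    assume less: "\<not> inner (fst z) (snd z) \<le> t"
    have z: "inner (fst z) a' + inner a (snd z) - inner a a' \<le> t" if "a' \<in> M a" for a a'
      using \<open>(z, t) \<in> K\<close> that by (auto simp: K_def)
    have "snd z \<in> M (fst z)"
    proof (rule maximal_monotone_opD[OF max])
      fix a a' assume "a' \<in> M a"
      from z[OF this] less show "0 \<le> inner (fst z - a) (snd z - a')"
        by (simp add: inner_simps)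
    qed
    from z[OF this] less show False by simp
  qed
  moreover have "0 \<le> t + (norm z)\<^sup>2 / 2" if "(z, t) \<in> K" for z t
  proof -
    have "0 \<le> (norm (fst z + snd z))\<^sup>2 / 2" by simp
    also have "\<dots> = inner (fst z) (snd z) + (norm z)\<^sup>2 / 2"
      by (simp add: power2_norm_eq_inner inner_prod_def inner_simps inner_commute field_simps)
    finally show ?thesis using low[OF that] by simp
  qed
  ultimately obtain z0 t0 where mem: "(z0, t0) \<in> K"
    and opt: "\<And>z t. (z, t) \<in> K \<Longrightarrow> 0 \<le> t - t0 + inner z0 (z - z0)"
    using hilbert_min_first_order[of K 0] by blast
  define x0 u0 where "x0 = fst z0" and "u0 = snd z0"
  have rel: "(norm (x0 + u0))\<^sup>2 \<le> inner (- u0 - a) (- x0 - a')" if "a' \<in> M a" for a a'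
    using opt[OF graph[OF that]] low[OF mem]
    by (simp add: x0_def u0_def power2_norm_eq_inner inner_prod_def inner_simps inner_commute)
  have "- x0 \<in> M (- u0)"
    by (rule maximal_monotone_opD[OF max]) (rule order_trans[OF zero_le_power2 rel])
  \<comment> \<open>At the graph point \<open>(- u0, - x0)\<close> itself the right-hand side of
    \<open>rel\<close> vanishes.\<close>
  moreover from rel[OF this] have "- u0 = x0"
    by (simp add: add_eq_0_iff)
  ultimately show ?thesis by auto
qed

text \<open>Scaling the values of \<open>M\<close> by \<open>c\<close> and translating them by
  \<open>- w\<close> preserves maximal monotonicity, and for the resulting operator \<open>N\<close>
  the claim reads \<open>- p \<in> N p\<close>.\<close>

theorem minty:
  fixes M :: "'a::{real_inner, complete_space} setop"
  assumes max: "maximal_monotone_op M" and "c > 0"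
  shows "\<exists>p. (1 / c) *\<^sub>R (w - p) \<in> M p"
proof -
  define N where "N = (\<lambda>p. {v. (1 / c) *\<^sub>R (v + w) \<in> M p})"
  have "maximal_monotone_op N"
    unfolding maximal_monotone_op_iff
  proof (intro conjI allI impI)
    have "0 \<le> inner (p - q) (v - v')" if "v \<in> N p" "v' \<in> N q" for p q v v'
    proof -
      have "0 \<le> inner (p - q) ((1 / c) *\<^sub>R (v + w) - (1 / c) *\<^sub>R (v' + w))"
        using that by (intro monotone_opD[OF maximal_monotone_op_monotone[OF max]]) (auto simp: N_def)
      also have "\<dots> = (1 / c) * inner (p - q) (v - v')"
        by (simp flip: scaleR_diff_right)
      finally show ?thesis using \<open>c > 0\<close> by (simp add: zero_le_divide_iff)
    qed
    then show "monotone_op N" by (auto simp: monotone_op_def graph_op_def)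
  next
    fix x u assume rel: "\<forall>a a'. a' \<in> N a \<longrightarrow> 0 \<le> inner (x - a) (u - a')"
    have "(1 / c) *\<^sub>R (u + w) \<in> M x"
    proof (rule maximal_monotone_opD[OF max])
      fix a a' assume "a' \<in> M a"
      then have "c *\<^sub>R a' - w \<in> N a" using \<open>c > 0\<close> by (simp add: N_def)
      with rel have "0 \<le> (1 / c) * inner (x - a) (u - (c *\<^sub>R a' - w))"
        using \<open>c > 0\<close> by simp
      also have "\<dots> = inner (x - a) ((1 / c) *\<^sub>R (u - (c *\<^sub>R a' - w)))" by simp
      also have "(1 / c) *\<^sub>R (u - (c *\<^sub>R a' - w)) = (1 / c) *\<^sub>R (u + w) - a'"
        using \<open>c > 0\<close> by (simp add: algebra_simps)
      finally show "0 \<le> inner (x - a) ((1 / c) *\<^sub>R (u + w) - a')" .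
    qed
    then show "u \<in> N x" by (simp add: N_def)
  qed
  from maximal_monotone_op_minus_mem[OF this] obtain p where "- p \<in> N p" by blast
  then show ?thesis by (auto simp: N_def)
qed

text \<open>Existence by Minty's theorem and uniqueness by monotonicity make the set under
  \<open>the_elem\<close> a singleton, so the resolvent satisfies its defining inclusion.\<close>

lemma resolvent_mem:
  fixes M :: "'a::{real_inner, complete_space} setop" and w :: 'a
  assumes max: "maximal_monotone_op M" and c: "c > 0"
  defines "p \<equiv> resolvent (c \<cdot>\<^sub>o M) w"
  shows "(1 / c) *\<^sub>R (w - p) \<in> M p"
proof -
  obtain q where q: "(1 / c) *\<^sub>R (w - q) \<in> M q"
    using minty[OF max c] by blast
  have "w \<in> {p} + (\<lambda>u. c *\<^sub>R u) ` M p \<longleftrightarrow> (1 / c) *\<^sub>R (w - p) \<in> M p" for p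
  proof
    assume "w \<in> {p} + (\<lambda>u. c *\<^sub>R u) ` M p"
    then show "(1 / c) *\<^sub>R (w - p) \<in> M p" using c by (auto simp: set_plus_def)
  next
    assume *: "(1 / c) *\<^sub>R (w - p) \<in> M p"
    have "w = p + c *\<^sub>R ((1 / c) *\<^sub>R (w - p))" using c by simp
    with * show "w \<in> {p} + (\<lambda>u. c *\<^sub>R u) ` M p" unfolding set_plus_def by blast
  qed
  then have "inverse_op (single_op id \<oplus>\<^sub>o c \<cdot>\<^sub>o M) w = {p. (1 / c) *\<^sub>R (w - p) \<in> M p}"
    by (simp add: inverse_op_def add_op_def single_op_def scale_op_def)
  also have "\<dots> = {q}"
  proof -
    have "p = q" if "(1 / c) *\<^sub>R (w - p) \<in> M p" for p
    proof -
      have "0 \<le> inner (p - q) ((1 / c) *\<^sub>R (w - p) - (1 / c) *\<^sub>R (w - q))"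
        by (rule monotone_opD[OF maximal_monotone_op_monotone[OF max] that q])
      also have "\<dots> = (1 / c) * inner (p - q) (q - p)"
        by (simp flip: scaleR_diff_right)
      also have "inner (p - q) (q - p) = - (norm (p - q))\<^sup>2"
        by (simp add: power2_norm_eq_inner inner_simps inner_commute)
      finally show ?thesis using c by (simp add: divide_le_0_iff)
    qed
    with q show ?thesis by blast
  qed
  finally show ?thesis using q by (simp add: p_def resolvent_def)
qed

text \<open>The counterpart of the maximality witness for \<open>C\<close>. Moving from
  \<open>x\<close> along \<open>d = w - C x\<close> by \<open>t = 1 / (2 * \<mu>)\<close> changes
  \<open>C\<close> by at most \<open>norm d / 2\<close>, so the residual \<open>w - C c\<close>
  still has a positive inner product with \<open>d\<close>.\<close>

lemma monotone_lipschitz_witness: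
  fixes C :: "'a::real_inner \<Rightarrow> 'a"
  assumes "\<mu>-lipschitz_on UNIV C" "\<mu> > 0"
  obtains c where "inner (x - c) (w - C c) \<le> 0"
    and "w \<noteq> C x \<Longrightarrow> inner (x - c) (w - C c) < 0"
proof (cases "w = C x")
  case True
  then show ?thesis using that[of x] by simp
next
  case False
  define d where "d = w - C x"
  define t where "t = 1 / (2 * \<mu>)"
  have t: "t > 0" using assms(2) by (simp add: t_def)
  have d: "d \<noteq> 0" using False by (simp add: d_def)
  have "norm (C (x + t *\<^sub>R d) - C x) \<le> \<mu> * (t * norm d)"
    using lipschitz_onD[OF assms(1), of "x + t *\<^sub>R d" x] t by (simp add: dist_norm)
  also have "\<dots> = norm d / 2" using assms(2) by (simp add: t_def)
  finally have "inner d (C (x + t *\<^sub>R d) - C x) \<le> norm d * (norm d / 2)"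
    using norm_cauchy_schwarz[of d "C (x + t *\<^sub>R d) - C x"] mult_left_mono[of _ "norm d / 2" "norm d"]
    by (meson norm_ge_zero order_trans)
  also have "\<dots> < inner d d"
    using d by (simp add: power2_norm_eq_inner[symmetric] power2_eq_square)
  finally have "0 < t * inner d (w - C (x + t *\<^sub>R d))"
    using t by (simp add: d_def inner_simps)
  then have "inner (x - (x + t *\<^sub>R d)) (w - C (x + t *\<^sub>R d)) < 0" by simp
  then show ?thesis using that[of "x + t *\<^sub>R d"] by simp
qed

section \<open>Passage to weak limits in the inclusions\<close>

lemma tendsto_inner_null_bounded:
  fixes g h :: "nat \<Rightarrow> 'a::real_inner"
  assumes "g \<longlonglongrightarrow> 0" "bounded (range h)"
  shows "(\<lambda>n. inner (g n) (h n)) \<longlonglongrightarrow> 0"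
proof -
  obtain K where "norm (h n) \<le> K" for n using assms(2) by (auto simp: bounded_iff)
  then have le: "norm (inner (g n) (h n)) \<le> norm (g n) * K" for n
    unfolding real_norm_def
    by (intro order_trans[OF Cauchy_Schwarz_ineq2] mult_left_mono norm_ge_zero)
  have "(\<lambda>n. norm (g n) * K) \<longlonglongrightarrow> 0"
    using assms(1) by (intro tendsto_mult_left_zero tendsto_norm_zero)
  then show ?thesis
    by (rule Lim_null_comparison[OF always_eventually, rotated]) (use le in blast)
qed

text \<open>
  Adding the three monotonicity inequalities cancels the terms \<open>\<langle>X, U\<rangle>\<close> and \<open>\<langle>X, C X\<rangle>\<close>, which
  are not weakly continuous; the remainder is affine in \<open>(X, U, C X)\<close>.
\<close>

lemma weak_limit_primal_dual_solution:
  fixes A B :: "'a::{real_inner, complete_space} setop"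
  assumes maxA: "maximal_monotone_op A" and maxB: "maximal_monotone_op B"
    and monoC: "monotone_op (single_op C)" and lip: "\<mu>-lipschitz_on UNIV C" and mu: "\<mu> > 0"
    and A: "\<And>n::nat. U n \<in> A (X n + e n)" and B: "\<And>n. f n - U n - C (X n) \<in> B (X n)"
    and e: "e \<longlonglongrightarrow> 0" and f: "f \<longlonglongrightarrow> 0"
    and bdd: "bounded (range X)" "bounded (range U)"
    and X: "X \<rightharpoonup> xb" and U: "U \<rightharpoonup> ub"
  shows "ub \<in> A xb" "- ub - C xb \<in> B xb"
proof -
  have "bounded (range (\<lambda>n. C (X n)))"
  proof -
    obtain K where K: "norm (X n) \<le> K" for n using bdd(1) by (auto simp: bounded_iff)
    have "norm (C (X n)) \<le> norm (C 0) + \<mu> * K" for n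
    proof -
      have "norm (C (X n) - C 0) \<le> \<mu> * norm (X n)"
        using lipschitz_onD[OF lip, of "X n" 0] by (simp add: dist_norm)
      also have "\<dots> \<le> \<mu> * K" using K mu by simp
      finally show ?thesis using norm_triangle_sub[of "C (X n)" "C 0"] by linarith
    qed
    then show ?thesis by (auto intro: boundedI)
  qed
  \<comment> \<open>Weak convergence of \<open>X\<close> does not by itself identify the limit of
    \<open>C (X n)\<close>; that \<open>w = C xb\<close> comes out together with the two
    memberships.\<close>
  then obtain w r where r: "strict_mono (r :: nat \<Rightarrow> nat)" and W: "((\<lambda>n. C (X n)) \<circ> r) \<rightharpoonup> w"
    using bounded_imp_weakly_convergent_subseq by blast
  have lims: "(\<lambda>n. inner (X (r n)) v) \<longlonglongrightarrow> inner xb v" "(\<lambda>n. inner (U (r n)) v) \<longlonglongrightarrow> inner ub v"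
    "(\<lambda>n. inner (C (X (r n))) v) \<longlonglongrightarrow> inner w v" for v
    using weakly_converges_subseq[OF X r] weakly_converges_subseq[OF U r] W
    by (auto simp: weakly_converges_def)
  have er: "(\<lambda>n. e (r n)) \<longlonglongrightarrow> 0" and fr: "(\<lambda>n. f (r n)) \<longlonglongrightarrow> 0"
    using LIMSEQ_subseq_LIMSEQ[OF e r] LIMSEQ_subseq_LIMSEQ[OF f r] by (simp_all add: o_def)
  have bddr: "bounded (range (\<lambda>n. X (r n)))" "bounded (range (\<lambda>n. U (r n)))"
    by (rule bounded_subset[OF bdd(1)], force, rule bounded_subset[OF bdd(2)], force)
  have ineq: "0 \<le> inner (xb - a) (ub - a') + inner (xb - b) (- ub - w - b')
      + inner (xb - c) (w - C c)" if "a' \<in> A a" "b' \<in> B b" for a a' b b' c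
  proof -
    define L where "L = (\<lambda>x u v. inner x (- a' - b' - C c) + inner u (b - a) + inner v (b - c)
      + (inner a a' + inner b b' + inner c (C c)))"
    have "0 \<le> L (X n) (U n) (C (X n)) + inner (e n) (U n) - inner (e n) a'
      + inner (f n) (X n) - inner (f n) b" for n
    proof -
      have "0 \<le> inner (X n + e n - a) (U n - a')"
        by (rule monotone_opD[OF maximal_monotone_op_monotone[OF maxA] A that(1)])
      moreover have "0 \<le> inner (X n - b) (f n - U n - C (X n) - b')"
        by (rule monotone_opD[OF maximal_monotone_op_monotone[OF maxB] B that(2)])
      moreover have "0 \<le> inner (X n - c) (C (X n) - C c)"
        by (rule monotone_opD[OF monoC]) (auto simp: single_op_def)
      ultimately show ?thesis
        by (simp add: L_def inner_simps inner_commute algebra_simps)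
    qed
    moreover have "(\<lambda>n. L (X (r n)) (U (r n)) (C (X (r n))) + inner (e (r n)) (U (r n))
        - inner (e (r n)) a' + inner (f (r n)) (X (r n)) - inner (f (r n)) b)
      \<longlonglongrightarrow> L xb ub w + 0 - inner 0 a' + 0 - inner 0 b"
      unfolding L_def
      by (intro tendsto_add tendsto_diff tendsto_const lims er fr bddr tendsto_inner
        tendsto_inner_null_bounded)
    ultimately have "0 \<le> L xb ub w + 0 - inner 0 a' + 0 - inner 0 b"
      by (intro tendsto_lowerbound) auto
    then show ?thesis by (simp add: L_def inner_simps inner_commute algebra_simps)
  qed
  obtain a a' where a: "a' \<in> A a" "inner (xb - a) (ub - a') \<le> 0"
    "ub \<notin> A xb \<Longrightarrow> inner (xb - a) (ub - a') < 0"
    using maximal_monotone_op_witness[OF maxA, where x = xb and u = ub] by blast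
  obtain b b' where b: "b' \<in> B b" "inner (xb - b) (- ub - w - b') \<le> 0"
    "- ub - w \<notin> B xb \<Longrightarrow> inner (xb - b) (- ub - w - b') < 0"
    using maximal_monotone_op_witness[OF maxB, where x = xb and u = "- ub - w"] by blast
  obtain c where c: "inner (xb - c) (w - C c) \<le> 0" "w \<noteq> C xb \<Longrightarrow> inner (xb - c) (w - C c) < 0"
    using monotone_lipschitz_witness[OF lip mu, where x = xb and w = w] by blast
  \<comment> \<open>The three summands are nonpositive with nonnegative sum, so none is strictly
    negative.\<close>
  from ineq[OF a(1) b(1), of c] a b c
  have "ub \<in> A xb" "- ub - w \<in> B xb" "w = C xb" by fastforce+
  then show "ub \<in> A xb" "- ub - C xb \<in> B xb" by auto
qed

section \<open>The primal-dual iteration\<close>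

text \<open>The constant \<open>c\<close> is determinant over trace of the matrix with diagonal
  \<open>k\<close>, \<open>b\<close> and off-diagonal entries -1. Then
  \<open>(k - c) * (b - c) = 1 + c^2\<close>, so the form stays nonnegative after subtracting
  \<open>c\<close> times the identity, by completing the square.\<close>

lemma quadratic_form_coercive:
  fixes k b :: real
  assumes "0 < k" "0 < b" "1 < k * b"
  obtains c where "c > 0"
    and "\<And>p q :: 'a::real_inner. c * ((norm p)\<^sup>2 + (norm q)\<^sup>2) \<le>
      k * (norm p)\<^sup>2 - 2 * inner p q + b * (norm q)\<^sup>2"
proof -
  define c where "c = (k * b - 1) / (k + b)"
  have c: "c * (k + b) = k * b - 1" "c > 0" using assms by (auto simp: c_def)
  have "c * (k + b) < k * (k + b)" using c(1) mult_pos_pos[OF assms(1) assms(1)] by (simp add: distrib_left)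
  then have ck: "c < k" using assms by simp
  have det: "(k - c) * (b - c) = 1 + c\<^sup>2" using c(1) by (simp add: algebra_simps power2_eq_square)
  have "c * ((norm p)\<^sup>2 + (norm q)\<^sup>2) \<le> k * (norm p)\<^sup>2 - 2 * inner p q + b * (norm q)\<^sup>2"
    for p q :: 'a
  proof -
    have "(k - c) * ((k - c) * (norm p)\<^sup>2 - 2 * (norm p * norm q) + (b - c) * (norm q)\<^sup>2)
      = ((k - c) * norm p - norm q)\<^sup>2 + ((k - c) * (b - c) - 1) * (norm q)\<^sup>2"
      by (simp add: power2_eq_square algebra_simps)
    also have "\<dots> \<ge> 0" unfolding det by simp
    finally have "0 \<le> (k - c) * (norm p)\<^sup>2 - 2 * (norm p * norm q) + (b - c) * (norm q)\<^sup>2"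
      using ck by (simp add: zero_le_mult_iff)
    with norm_cauchy_schwarz[of p q] show ?thesis by (simp add: algebra_simps)
  qed
  with c(2) show ?thesis using that by blast
qed

text \<open>The resolvent steps as inclusions, with \<open>y\<close> eliminated through the update
  of \<open>u\<close>. Indices of \<open>x\<close> are shifted: \<open>x 0\<close> and
  \<open>x 1\<close> are the starting points, and \<open>u n\<close> is paired with
  \<open>x (n + 1)\<close>.\<close>

locale primal_dual_forward_reflected =
  fixes A B :: "'a::{real_inner, complete_space} setop" and C :: "'a \<Rightarrow> 'a"
    and \<mu> \<beta> \<gamma> :: real and x u :: "nat \<Rightarrow> 'a"
  assumes maxA: "maximal_monotone_op A" and maxB: "maximal_monotone_op B"
    and monoC: "monotone_op (single_op C)" and lip: "\<mu>-lipschitz_on UNIV C"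
    and mu: "\<mu> > 0" and beta: "\<beta> > 0" and step_size: "1 / \<beta> + 2 * \<mu> < 1 / \<gamma>"
    and B_step: "\<And>n. (1 / \<gamma>) *\<^sub>R (x (n + 1) - x (n + 2)) - u n - (2 *\<^sub>R C (x (n + 1)) - C (x n))
      \<in> B (x (n + 2))"
    and A_step: "\<And>n. u (n + 1) \<in> A (2 *\<^sub>R x (n + 2) - x (n + 1) - \<beta> *\<^sub>R (u (n + 1) - u n))"
begin

definition solution :: "'a \<Rightarrow> 'a \<Rightarrow> bool" where
  "solution xs us \<longleftrightarrow> us \<in> A xs \<and> - us - C xs \<in> B xs"

definition V :: "'a \<Rightarrow> 'a \<Rightarrow> real" where
  "V p q = (1 / \<gamma>) * (norm p)\<^sup>2 - 2 * inner p q + \<beta> * (norm q)\<^sup>2"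

definition energy :: "'a \<Rightarrow> 'a \<Rightarrow> nat \<Rightarrow> real" where
  "energy xs us n = V (x (n + 1) - xs) (u n - us)
     - 2 * inner (C (x (n + 1)) - C (x n)) (x (n + 1) - xs) + \<mu> * (norm (x (n + 1) - x n))\<^sup>2"

section \<open>Energy estimates\<close>

lemma norm_C_diff: "norm (C a - C b) \<le> \<mu> * norm (a - b)"
  using lipschitz_onD[OF lip, of a b] by (simp add: dist_norm)

lemma C_diff_null:
  assumes "(\<lambda>n. a n - b n) \<longlonglongrightarrow> 0"
  shows "(\<lambda>n. C (a n) - C (b n)) \<longlonglongrightarrow> 0"
proof (rule Lim_null_comparison)
  show "\<forall>\<^sub>F n in sequentially. norm (C (a n) - C (b n)) \<le> \<mu> * norm (a n - b n)"
    using norm_C_diff by simp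
  show "(\<lambda>n. \<mu> * norm (a n - b n)) \<longlonglongrightarrow> 0"
    by (intro tendsto_mult_right_zero tendsto_norm_zero assms)
qed

lemma inner_C_diff_le: "2 * \<bar>inner (C a - C b) v\<bar> \<le> \<mu> * ((norm (a - b))\<^sup>2 + (norm v)\<^sup>2)"
proof -
  have "\<bar>inner (C a - C b) v\<bar> \<le> \<mu> * (norm (a - b) * norm v)"
    using Cauchy_Schwarz_ineq2[of "C a - C b" v] mult_right_mono[OF norm_C_diff[of a b] norm_ge_zero[of v]]
    by simp
  moreover have "\<mu> * (2 * (norm (a - b) * norm v)) \<le> \<mu> * ((norm (a - b))\<^sup>2 + (norm v)\<^sup>2)"
    using sum_squares_bound[of "norm (a - b)" "norm v"] mu by (intro mult_left_mono) auto
  ultimately show ?thesis by simp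
qed

text \<open>With \<open>k = 1 / \<gamma> - 2 * \<mu>\<close> the step-size condition is the
  determinant condition \<open>k * \<beta> > 1\<close>.\<close>

lemma coercive:
  obtains c where "c > 0"
    and "\<And>p q :: 'a. c * ((norm p)\<^sup>2 + (norm q)\<^sup>2) \<le>
      (1 / \<gamma> - 2 * \<mu>) * (norm p)\<^sup>2 - 2 * inner p q + \<beta> * (norm q)\<^sup>2"
proof (rule quadratic_form_coercive)
  have k: "1 / \<beta> < 1 / \<gamma> - 2 * \<mu>" using step_size by simp
  moreover have "0 < 1 / \<beta>" using beta by simp
  ultimately show "0 < 1 / \<gamma> - 2 * \<mu>" by linarith
  show "1 < (1 / \<gamma> - 2 * \<mu>) * \<beta>"
    using mult_strict_right_mono[OF k beta] beta by simp
qed (use beta that in auto)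

text \<open>
  The inequality is twice the sum of the monotonicity inequalities of \<open>A\<close>, \<open>B\<close> and \<open>C\<close> between
  the iterates and the solution, with the reflected evaluations of \<open>C\<close> telescoping.
\<close>

lemma energy_decrease:
  assumes "solution xs us"
  shows "energy xs us (n + 1) + ((1 / \<gamma> - 2 * \<mu>) * (norm (x (n + 2) - x (n + 1)))\<^sup>2
      - 2 * inner (x (n + 2) - x (n + 1)) (u (n + 1) - u n) + \<beta> * (norm (u (n + 1) - u n))\<^sup>2)
    \<le> energy xs us n"
proof -
  define g where "g = 1 / \<gamma>"
  define tA where "tA = inner (2 *\<^sub>R x (n + 2) - x (n + 1) - \<beta> *\<^sub>R (u (n + 1) - u n) - xs)
    (u (n + 1) - us)"
  define tB where "tB = inner (x (n + 2) - xs)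
    (g *\<^sub>R (x (n + 1) - x (n + 2)) - u n - (2 *\<^sub>R C (x (n + 1)) - C (x n)) - (- us - C xs))"
  define tC where "tC = inner (x (n + 2) - xs) (C (x (n + 2)) - C xs)"
  \<comment> \<open>Slack in Young's inequality for the cross term that remains when
    \<open>x (n + 2) - xs\<close> is split at \<open>x (n + 1)\<close>. One \<mu> of the loss
    \<open>2 * \<mu>\<close> comes from here, the other from the last term of the energy at
    \<open>n + 1\<close>.\<close>
  define tL where "tL = \<mu> * ((norm (x (n + 1) - x n))\<^sup>2 + (norm (x (n + 2) - x (n + 1)))\<^sup>2)
    + 2 * inner (C (x (n + 1)) - C (x n)) (x (n + 2) - x (n + 1))"
  have "0 \<le> tA"
    unfolding tA_def using assms A_step
    by (intro monotone_opD[OF maximal_monotone_op_monotone[OF maxA]]) (auto simp: solution_def)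
  moreover have "0 \<le> tB"
    unfolding tB_def g_def using assms B_step
    by (intro monotone_opD[OF maximal_monotone_op_monotone[OF maxB]]) (auto simp: solution_def)
  moreover have "0 \<le> tC"
    unfolding tC_def by (rule monotone_opD[OF monoC]) (auto simp: single_op_def)
  moreover have "0 \<le> tL"
    using inner_C_diff_le[of "x (n + 1)" "x n" "x (n + 2) - x (n + 1)"] unfolding tL_def by linarith
  moreover have "energy xs us n - energy xs us (n + 1)
      - ((g - 2 * \<mu>) * (norm (x (n + 2) - x (n + 1)))\<^sup>2
      - 2 * inner (x (n + 2) - x (n + 1)) (u (n + 1) - u n) + \<beta> * (norm (u (n + 1) - u n))\<^sup>2)
    = 2 * tA + 2 * tB + 2 * tC + tL"
    unfolding energy_def V_def tA_def tB_def tC_def tL_def g_def[symmetric]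
    by (simp add: power2_norm_eq_inner inner_simps inner_commute algebra_simps)
  ultimately show ?thesis by (simp add: g_def)
qed

text \<open>Young's inequality costs only one multiple of \<mu>; a second is given away so that the
  same coercive form bounds both the energy and its decrease.\<close>

lemma energy_lower:
  "(1 / \<gamma> - 2 * \<mu>) * (norm (x (n + 1) - xs))\<^sup>2 - 2 * inner (x (n + 1) - xs) (u n - us)
    + \<beta> * (norm (u n - us))\<^sup>2 \<le> energy xs us n"
proof -
  have "0 \<le> \<mu> * (norm (x (n + 1) - xs))\<^sup>2" using mu by simp
  with inner_C_diff_le[of "x (n + 1)" "x n" "x (n + 1) - xs"] show ?thesis
    unfolding energy_def V_def left_diff_distrib distrib_left by linarith
qed

text \<open>The energy decreases and is nonnegative, hence converges. Its decrements control the
  increments, its values control the distance to the solution, and its difference from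
  \<open>V\<close> tends to 0.\<close>

lemma asymptotics:
  assumes sol: "solution xs us"
  shows "bounded (range x)" "bounded (range u)"
    and "(\<lambda>n. x (n + 1) - x n) \<longlonglongrightarrow> 0" "(\<lambda>n. u (n + 1) - u n) \<longlonglongrightarrow> 0"
    and "convergent (\<lambda>n. V (x (n + 1) - xs) (u n - us))"
proof -
  obtain c where c: "c > 0" and coer: "\<And>p q :: 'a. c * ((norm p)\<^sup>2 + (norm q)\<^sup>2) \<le>
      (1 / \<gamma> - 2 * \<mu>) * (norm p)\<^sup>2 - 2 * inner p q + \<beta> * (norm q)\<^sup>2"
    using coercive by blast
  define E where "E = energy xs us"
  have dec: "c * ((norm (x (n + 2) - x (n + 1)))\<^sup>2 + (norm (u (n + 1) - u n))\<^sup>2) \<le> E n - E (n + 1)" for n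
    using order_trans[OF add_left_mono[OF coer] energy_decrease[OF sol, of n]]
    by (simp add: E_def algebra_simps)
  have low: "c * ((norm (x (n + 1) - xs))\<^sup>2 + (norm (u n - us))\<^sup>2) \<le> E n" for n
    using order_trans[OF coer energy_lower] by (simp add: E_def)
  have "E (Suc n) \<le> E n" for n
    using dec[of n] c by (smt (verit) Suc_eq_plus1 mult_nonneg_nonneg zero_le_power2)
  then have "decseq E" by (rule decseq_SucI)
  moreover have E0: "0 \<le> E n" for n
    using low[of n] c by (smt (verit) mult_nonneg_nonneg zero_le_power2)
  ultimately obtain l where El: "E \<longlonglongrightarrow> l" using decseq_convergent by blast
  have "(\<lambda>n. (E n - E (n + 1)) / c) \<longlonglongrightarrow> (l - l) / c"
    using LIMSEQ_ignore_initial_segment[OF El, of 1] c by (intro tendsto_intros El) auto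
  then have "(\<lambda>n. (E n - E (n + 1)) / c) \<longlonglongrightarrow> 0" by simp
  from tendsto_real_sqrt[OF this] have lim0: "(\<lambda>n. sqrt ((E n - E (n + 1)) / c)) \<longlonglongrightarrow> 0" by simp
  have "(norm (x (n + 2) - x (n + 1)))\<^sup>2 + (norm (u (n + 1) - u n))\<^sup>2 \<le> (E n - E (n + 1)) / c" for n
    using dec[of n] c by (simp add: field_simps)
  then have le: "norm (x (n + 2) - x (n + 1)) \<le> sqrt ((E n - E (n + 1)) / c)"
    "norm (u (n + 1) - u n) \<le> sqrt ((E n - E (n + 1)) / c)" for n
    by (smt (verit) real_le_rsqrt zero_le_power2)+
  show du: "(\<lambda>n. u (n + 1) - u n) \<longlonglongrightarrow> 0"
    using le(2) by (intro Lim_null_comparison[OF _ lim0]) auto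
  have "(\<lambda>n. x (n + 2) - x (n + 1)) \<longlonglongrightarrow> 0"
    using le(1) by (intro Lim_null_comparison[OF _ lim0]) auto
  then show dx: "(\<lambda>n. x (n + 1) - x n) \<longlonglongrightarrow> 0"
    using LIMSEQ_offset[of "\<lambda>n. x (n + 1) - x n" 1 0] by (simp add: add.assoc)
  have En: "E n \<le> E 0" for n using \<open>decseq E\<close> by (simp add: decseq_def)
  have "(norm (x (n + 1) - xs))\<^sup>2 + (norm (u n - us))\<^sup>2 \<le> E 0 / c" for n
    using low[of n] En[of n] c by (simp add: field_simps)
  then have bn: "norm (x (n + 1) - xs) \<le> sqrt (E 0 / c)" "norm (u n - us) \<le> sqrt (E 0 / c)" for n
    by (smt (verit) real_le_rsqrt zero_le_power2)+
  then have bx: "bounded (range (\<lambda>n. x (n + 1) - xs))" and bu: "bounded (range (\<lambda>n. u n - us))"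
    by (auto intro: boundedI)
  show "bounded (range u)"
    using bounded_translation[OF bu, of us] by (simp add: image_image)
  \<comment> \<open>The energy sees only \<open>x (n + 1)\<close>, so \<open>x 0\<close> is added by
    hand.\<close>
  have "range x \<subseteq> insert (x 0) (range (\<lambda>n. xs + (x (n + 1) - xs)))"
  proof (clarify)
    fix n assume "x n \<notin> range (\<lambda>n. xs + (x (n + 1) - xs))"
    then show "x n = x 0" by (cases n) auto
  qed
  moreover have "bounded (insert (x 0) (range (\<lambda>n. xs + (x (n + 1) - xs))))"
    using bounded_translation[OF bx, of xs] unfolding bounded_insert by (simp only: image_image)
  ultimately show "bounded (range x)" using bounded_subset by blast
  have "(\<lambda>n. C (x (n + 1)) - C (x n)) \<longlonglongrightarrow> 0"
    by (rule C_diff_null[OF dx])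
  from tendsto_inner_null_bounded[OF this bx]
  have "(\<lambda>n. E n + 2 * inner (C (x (n + 1)) - C (x n)) (x (n + 1) - xs)
      - \<mu> * (norm (x (n + 1) - x n))\<^sup>2) \<longlonglongrightarrow> l + 2 * 0 - \<mu> * (norm (0 :: 'a))\<^sup>2"
    by (intro tendsto_intros El dx)
  then show "convergent (\<lambda>n. V (x (n + 1) - xs) (u n - us))"
    by (auto simp: E_def energy_def convergent_def)
qed

text \<open>Each step is an exact inclusion at \<open>(x (n + 2), u (n + 1))\<close> up to errors
  built from increments of \<open>x\<close>, \<open>u\<close> and \<open>C x\<close>. These vanish,
  so the inclusions pass to the weak limit.\<close>

lemma weak_cluster_point_solution:
  assumes sol: "solution xs us" and r: "strict_mono r"
    and X: "(\<lambda>n. x (r n + 1)) \<rightharpoonup> xb" and U: "(\<lambda>n. u (r n)) \<rightharpoonup> ub"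
  shows "solution xb ub"
proof -
  note asym = asymptotics[OF sol]
  note dC = C_diff_null[OF asym(3)]
  have sub: "(\<lambda>n. g (r n)) \<longlonglongrightarrow> 0" "(\<lambda>n. g (r n + 1)) \<longlonglongrightarrow> 0" if "g \<longlonglongrightarrow> 0" for g :: "nat \<Rightarrow> 'a"
    using LIMSEQ_subseq_LIMSEQ[OF that r]
      LIMSEQ_subseq_LIMSEQ[OF LIMSEQ_ignore_initial_segment[OF that, of 1] r]
    by (simp_all add: o_def)
  note dx1 = sub(2)[OF asym(3), simplified add.assoc one_add_one]
  note dC1 = sub(2)[OF dC, simplified add.assoc one_add_one]
  define e where "e = (\<lambda>n. (x (r n + 2) - x (r n + 1)) - \<beta> *\<^sub>R (u (r n + 1) - u (r n)))"
  define f where "f = (\<lambda>n. (u (r n + 1) - u (r n)) - (1 / \<gamma>) *\<^sub>R (x (r n + 2) - x (r n + 1))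
    + (C (x (r n + 2)) - C (x (r n + 1))) - (C (x (r n + 1)) - C (x (r n))))"
  have "e \<longlonglongrightarrow> 0 - \<beta> *\<^sub>R 0"
    unfolding e_def by (intro tendsto_intros dx1 sub(1)[OF asym(4)])
  then have e: "e \<longlonglongrightarrow> 0" by simp
  have "f \<longlonglongrightarrow> 0 - (1 / \<gamma>) *\<^sub>R 0 + 0 - 0"
    unfolding f_def by (intro tendsto_add tendsto_diff tendsto_scaleR tendsto_const
        dx1 dC1 sub(1)[OF asym(4)] sub(1)[OF dC])
  then have f: "f \<longlonglongrightarrow> 0" by simp
  have A_mem: "u (r n + 1) \<in> A (x (r n + 2) + e n)" for n
  proof -
    have "x (r n + 2) + e n = 2 *\<^sub>R x (r n + 2) - x (r n + 1) - \<beta> *\<^sub>R (u (r n + 1) - u (r n))"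
      by (simp add: e_def scaleR_2)
    with A_step[of "r n"] show ?thesis by simp
  qed
  have B_mem: "f n - u (r n + 1) - C (x (r n + 2)) \<in> B (x (r n + 2))" for n
  proof -
    have "f n - u (r n + 1) - C (x (r n + 2)) =
      (1 / \<gamma>) *\<^sub>R (x (r n + 1) - x (r n + 2)) - u (r n) - (2 *\<^sub>R C (x (r n + 1)) - C (x (r n)))"
      by (simp add: f_def scaleR_2 scaleR_diff_right)
    with B_step[of "r n"] show ?thesis by simp
  qed
  have "bounded (range (\<lambda>n. x (r n + 2)))" by (rule bounded_subset[OF asym(1)]) auto
  moreover have "bounded (range (\<lambda>n. u (r n + 1)))" by (rule bounded_subset[OF asym(2)]) auto
  moreover have "(\<lambda>n. x (r n + 2)) \<rightharpoonup> xb" by (rule weakly_converges_add_null[OF X dx1])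
  moreover have "(\<lambda>n. u (r n + 1)) \<rightharpoonup> ub" by (rule weakly_converges_add_null[OF U sub(1)[OF asym(4)]])
  ultimately have "ub \<in> A xb" "- ub - C xb \<in> B xb"
    using weak_limit_primal_dual_solution[OF maxA maxB monoC lip mu A_mem B_mem e f] by blast+
  then show ?thesis by (simp add: solution_def)
qed

text \<open>
  Opial's argument: \<open>V\<close> of the distance to either solution converges, hence so does the
  difference, which is affine in the iterates.
\<close>

lemma weak_cluster_point_unique:
  assumes sol: "solution x1 u1" "solution x2 u2"
    and r: "strict_mono r" "(\<lambda>n. x (r n + 1)) \<rightharpoonup> x1" "(\<lambda>n. u (r n)) \<rightharpoonup> u1"
    and s: "strict_mono s" "(\<lambda>n. x (s n + 1)) \<rightharpoonup> x2" "(\<lambda>n. u (s n)) \<rightharpoonup> u2"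
  shows "x1 = x2 \<and> u1 = u2"
proof -
  \<comment> \<open>The linear part of the difference of the two squared distances; the quadratic
    terms in \<open>(a, b)\<close> cancel, and \<open>k\<close> is the constant part.\<close>
  define G where "G = (\<lambda>a b. - (2 / \<gamma>) * inner a (x1 - x2) + 2 * inner a (u1 - u2)
    + 2 * inner b (x1 - x2) - 2 * \<beta> * inner b (u1 - u2))"
  define k where "k = V x1 u1 - V x2 u2"
  have G: "V (a - x1) (b - u1) - V (a - x2) (b - u2) = G a b + k" for a b
    by (simp add: V_def G_def k_def power2_norm_eq_inner inner_simps inner_commute algebra_simps
        diff_divide_distrib add_divide_distrib)
  have "convergent (\<lambda>n. G (x (n + 1)) (u n) + k)"
    using convergent_diff[OF asymptotics(5)[OF sol(1)] asymptotics(5)[OF sol(2)]] by (simp only: G)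
  then obtain l where l: "(\<lambda>n. G (x (n + 1)) (u n) + k) \<longlonglongrightarrow> l" by (auto simp: convergent_def)
  have "(\<lambda>n. G (x (r n + 1)) (u (r n)) + k) \<longlonglongrightarrow> G x1 u1 + k"
    unfolding G_def using r(2,3)
    by (intro tendsto_add tendsto_diff tendsto_mult tendsto_const) (auto simp: weakly_converges_def)
  moreover have "(\<lambda>n. G (x (s n + 1)) (u (s n)) + k) \<longlonglongrightarrow> G x2 u2 + k"
    unfolding G_def using s(2,3)
    by (intro tendsto_add tendsto_diff tendsto_mult tendsto_const) (auto simp: weakly_converges_def)
  ultimately have "G x1 u1 = G x2 u2"
    using LIMSEQ_subseq_LIMSEQ[OF l r(1)] LIMSEQ_subseq_LIMSEQ[OF l s(1)]
    by (auto simp: o_def dest: LIMSEQ_unique)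
  moreover have "G x1 u1 - G x2 u2 = - 2 * V (x1 - x2) (u1 - u2)"
    by (simp add: V_def G_def power2_norm_eq_inner inner_simps inner_commute algebra_simps
        diff_divide_distrib add_divide_distrib)
  ultimately have V0: "V (x1 - x2) (u1 - u2) = 0" by simp
  obtain c where c: "c > 0" and coer: "\<And>p q :: 'a. c * ((norm p)\<^sup>2 + (norm q)\<^sup>2) \<le>
      (1 / \<gamma> - 2 * \<mu>) * (norm p)\<^sup>2 - 2 * inner p q + \<beta> * (norm q)\<^sup>2"
    using coercive by blast
  \<comment> \<open>\<open>V\<close> exceeds the coercive form by this term, so \<open>V\<close> is
    definite as well.\<close>
  have "0 \<le> 2 * \<mu> * (norm (x1 - x2))\<^sup>2" using mu by simp
  with coer[of "x1 - x2" "u1 - u2"] V0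
  have "c * ((norm (x1 - x2))\<^sup>2 + (norm (u1 - u2))\<^sup>2) \<le> 0"
    by (simp add: V_def left_diff_distrib)
  with c show ?thesis
    by (simp add: mult_le_0_iff sum_power2_le_zero_iff)
qed

theorem weak_convergence:
  assumes sol: "solution xs us"
  obtains xb ub where "solution xb ub" "x \<rightharpoonup> xb"
proof -
  \<comment> \<open>Cluster points are taken for the pair in the product space: uniqueness is known
    only for primal and dual limits along a common subsequence.\<close>
  define z where "z = (\<lambda>n. (x (n + 1), u n))"
  note asym = asymptotics[OF sol]
  have bz: "bounded (range z)"
    by (rule bounded_subset[OF bounded_Times[OF asym(1,2)]]) (auto simp: z_def)
  have comp: "(\<lambda>n. x (r n + 1)) \<rightharpoonup> fst l" "(\<lambda>n. u (r n)) \<rightharpoonup> snd l" if "(z \<circ> r) \<rightharpoonup> l" for r l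
    using weakly_converges_fst_snd[OF that] by (simp_all add: z_def)
  obtain l r where r: "strict_mono r" "(z \<circ> r) \<rightharpoonup> l"
    using bounded_imp_weakly_convergent_subseq[OF bz] by blast
  have sl: "solution (fst l) (snd l)"
    by (rule weak_cluster_point_solution[OF sol r(1) comp[OF r(2)]])
  have "z \<rightharpoonup> l"
  proof (rule weakly_convergesI_unique_cluster[OF bz])
    fix s l' assume s: "strict_mono s" "(z \<circ> s) \<rightharpoonup> l'"
    have "solution (fst l') (snd l')"
      by (rule weak_cluster_point_solution[OF sol s(1) comp[OF s(2)]])
    from weak_cluster_point_unique[OF this sl s(1) comp[OF s(2)] r(1) comp[OF r(2)]]
    show "l' = l" by (simp add: prod_eq_iff)
  qed
  from weakly_converges_fst_snd(1)[OF this] have "(\<lambda>n. x (n + 1)) \<rightharpoonup> fst l"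
    by (simp add: z_def)
  then have "x \<rightharpoonup> fst l"
    unfolding weakly_converges_def
  proof (intro allI)
    fix y assume "\<forall>y. (\<lambda>n. inner (x (n + 1)) y) \<longlonglongrightarrow> inner (fst l) y"
    then show "(\<lambda>n. inner (x n) y) \<longlonglongrightarrow> inner (fst l) y"
      by (intro LIMSEQ_offset[of "\<lambda>n. inner (x n) y" 1]) blast
  qed
  with sl show ?thesis using that by blast
qed

end

section \<open>From the resolvent recursion to the inclusions\<close>

lemma zer_sum_iff:
  "p \<in> zer (A \<oplus>\<^sub>o B \<oplus>\<^sub>o single_op C) \<longleftrightarrow> (\<exists>v \<in> A p. - v - C p \<in> B p)"
proof -
  have "0 = v + w + C p \<longleftrightarrow> w = - v - C p" for v w :: 'a
    by (metis add.assoc add.commute eq_neg_iff_add_eq_0 minus_add uminus_add_conv_diff)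
  then show ?thesis
    by (auto simp: zer_def add_op_def single_op_def set_plus_def)
qed

theorem theorem5p1:
  fixes A B :: "'a::{real_inner, complete_space} \<Rightarrow> 'a set"
    and C :: "'a \<Rightarrow> 'a"
    and \<mu> \<beta> \<gamma> :: real
    and x :: "int \<Rightarrow> 'a"
    and y u :: "nat \<Rightarrow> 'a"
  assumes "\<mu> > 0"
    and "maximal_monotone_op A"
    and "maximal_monotone_op B"
    and "monotone_op (single_op C)"
    and "\<mu>-lipschitz_on UNIV C"
    and "zer (A \<oplus>\<^sub>o B \<oplus>\<^sub>o single_op C) \<noteq> {}"
    and "\<beta> > 0"
    and "0 < \<gamma>" and "\<gamma> < \<beta> / (1 + 2 * \<mu> * \<beta>)"
    and "\<And>n::nat. x (int n + 1) =
           resolvent (\<gamma> \<cdot>\<^sub>o B)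
             (x (int n) - \<gamma> *\<^sub>R u n - \<gamma> *\<^sub>R (2 *\<^sub>R C (x (int n)) - C (x (int n - 1))))"
    and "\<And>n::nat. y (n + 1) =
           resolvent (\<beta> \<cdot>\<^sub>o A) (2 *\<^sub>R x (int n + 1) - x (int n) + \<beta> *\<^sub>R u n)"
    and "\<And>n::nat. u (n + 1) =
           u n + (1 / \<beta>) *\<^sub>R (2 *\<^sub>R x (int n + 1) - x (int n) - y (n + 1))"
  shows "\<exists>xstar \<in> zer (A \<oplus>\<^sub>o B \<oplus>\<^sub>o single_op C). (\<lambda>n::nat. x (int n)) \<rightharpoonup> xstar"
proof -
  \<comment> \<open>Shifted so that the two starting points are \<open>x' 0 = x (-1)\<close> and \<open>x' 1 = x 0\<close>.\<close>
  define x' where "x' = (\<lambda>n. x (int n - 1))"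
  interpret primal_dual_forward_reflected A B C \<mu> \<beta> \<gamma> x' u
  proof
    have "0 < 1 + 2 * \<mu> * \<beta>" using assms(1,7) by (simp add: add_pos_pos)
    \<comment> \<open>Reciprocals of the upper bound on \<gamma>.\<close>
    then show "1 / \<beta> + 2 * \<mu> < 1 / \<gamma>"
      using assms(7-9) by (simp add: field_simps)
    fix n
    define w where "w = x (int n) - \<gamma> *\<^sub>R u n - \<gamma> *\<^sub>R (2 *\<^sub>R C (x (int n)) - C (x (int n - 1)))"
    have "(1 / \<gamma>) *\<^sub>R (w - x (int n + 1)) \<in> B (x (int n + 1))"
      using resolvent_mem[OF assms(3,8), of w] assms(10)[of n] by (simp add: w_def)
    moreover have "(1 / \<gamma>) *\<^sub>R (w - x (int n + 1)) = (1 / \<gamma>) *\<^sub>R (x (int n) - x (int n + 1)) - u n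
      - (2 *\<^sub>R C (x (int n)) - C (x (int n - 1)))"
      using assms(8) by (simp add: w_def scaleR_diff_right)
    ultimately show "(1 / \<gamma>) *\<^sub>R (x' (n + 1) - x' (n + 2)) - u n - (2 *\<^sub>R C (x' (n + 1)) - C (x' n))
      \<in> B (x' (n + 2))"
      by (simp add: x'_def add.commute)
    define v where "v = 2 *\<^sub>R x (int n + 1) - x (int n) + \<beta> *\<^sub>R u n"
    have "(1 / \<beta>) *\<^sub>R (v - y (n + 1)) \<in> A (y (n + 1))"
      using resolvent_mem[OF assms(2,7), of v] assms(11)[of n] by (simp add: v_def)
    \<comment> \<open>The update of \<open>u\<close> is precisely the element of
      \<open>A (y (n + 1))\<close> that the resolvent step selects.\<close>
    moreover have "(1 / \<beta>) *\<^sub>R (v - y (n + 1)) = u (n + 1)"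
      using assms(7) assms(12)[of n] by (simp add: v_def algebra_simps)
    moreover have "y (n + 1) = 2 *\<^sub>R x (int n + 1) - x (int n) - \<beta> *\<^sub>R (u (n + 1) - u n)"
      using assms(7) assms(12)[of n] by simp
    ultimately show "u (n + 1) \<in> A (2 *\<^sub>R x' (n + 2) - x' (n + 1) - \<beta> *\<^sub>R (u (n + 1) - u n))"
      by (simp add: x'_def add.commute)
  qed (use assms in auto)
  obtain p v where "solution p v"
    using assms(6) unfolding solution_def ex_in_conv[symmetric] zer_sum_iff by blast
  then obtain xb ub where "solution xb ub" "x' \<rightharpoonup> xb"
    using weak_convergence by blast
  moreover from this(2) have "(\<lambda>n. x' (n + 1)) \<rightharpoonup> xb"
    unfolding weakly_converges_def by (intro allI LIMSEQ_ignore_initial_segment) blast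
  ultimately show ?thesis
    by (intro bexI[of _ xb]) (auto simp: x'_def solution_def zer_sum_iff)
qed

end
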